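(* Let $H_i$ be an $M$-object hypothesis at time $t-1$ with weight $w_i$, and let $H_{ij}$ be its children hypotheses, where $H_{ij}$ corresponds to the data association $\{z_k \to X_{j_k}\}_{k=1}^m$ of the $m$ measurements $\{Z_t\}=\{z_1,\dots,z_m\}$ received at time $t$. Then the joint density of the multi-object state and the hypothesis is updated according to $$p(\{X\},(i,j)/\mathcal{F}^t)=p(\{X\}/(i,j),\mathcal{F}^t)\,\frac{w_{ij}\,l_{ij}}{\sum_{i',j'}w_{i'j'}\,l_{i'j'}},$$ where $w_{ij}=p_{ij}w_i$, $$l_{ij}=\prod_{k=1}^m p(z_k/X_{j_k}),\qquad p(z_k/X_{j_k})=\begin{cases}\int p(z_k/x)\,p^-_{j_k}(x)\,dx & \text{if } X_{j_k}\in\mathcal{T},\\ g(z_k) & \text{if } X_{j_k}\in\mathcal{C},\end{cases}$$ and the multi-object pdf underlying $H_{ij}$ is $$p(\{X\}/(i,j),\mathcal{F}^t)=\prod_{k} p_{j_k}(x_{j_k}/z_k)\prod_{l} p_l^-(x_l),$$ where the first product is over the measurement indices $k$ with $X_{j_k}\in\mathcal{T}$ and the second is over all objects $l$ that are not associated with any measurement under $H_{ij}$. Here $p_{j_k}(x_{j_k}/z_k)$ is the predicted prior $p^-_{j_k}(x_{j_k})$ of object $X_{j_k}$ updated by the observation $z_k$ (by Bayes' rule), and $p_l^-(x_l)$ is the predicted prior of the unassociated object $X_l$.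
   Context: Multi-object tracking with a fixed number $M$ of objects (no birth or death), each with state in $\mathbb{R}^N$. $\mathcal{F}^{t-1}$ is the data up to time $t-1$, and $\mathcal{F}^t$ adds the measurements $\{Z_t\}$. A finite family of hypotheses $H_i$ is given at time $t-1$, with $w_i=p(i/\mathcal{F}^{t-1})$ the probability of $H_i$. Notation: "$a/b$" inside $p(\cdot)$ means $a$ conditioned on $b$, and $\{X\}=\{X_1,\dots,X_M\}$ is the multi-object state. Prior: the joint density of state and hypothesis is $p(\{X\},i/\mathcal{F}^{t-1})=w_i\,p(\{X\}/i,\mathcal{F}^{t-1})$, and given the hypothesis $H_i$ the objects are independent, with labelled components: $p(\{X\}/i,\mathcal{F}^{t-1})=\prod_{k=1}^M p_k(x_k)$, where the individual pdfs $p_k$ depend on $i$ (suppressed in the notation). Children and prediction: each $H_i$ splits into children $H_{ij}$, one for each data association of the $m$ measurements. In a data association each measurement $z_k$ is assigned to $X_{j_k}$, which is either an object ($X_{j_k}\in\mathcal{T}$, the set of all objects) or clutter ($X_{j_k}\in\mathcal{C}$), and each object is assigned to at most one measurement. The probability of passing from $H_i$ to $H_{ij}$ is $p_{ij}=p(j/i)$; it does not depend on the continuous state. Objects move independently with transition densities $p_k(x_k/x_k')$, so $p(\{X\}/(i,j),\{X'\})=\prod_{k=1}^M p_k(x_k/x'_k)$. The predicted joint density is $$p^-(\{X\},(i,j)/\mathcal{F}^{t-1})=\int p(\{X\},(i,j)/\{X'\},i)\,p(\{X'\},i/\mathcal{F}^{t-1})\,d\{X'\},$$ with $p(\{X\},(i,j)/\{X'\},i)=p(\{X\}/(i,j),\{X'\})\,p_{ij}$.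 The predicted prior of object $k$ is $p_k^-(x_k)=\int p_k(x_k/x_k')p_k(x_k')\,dx_k'$. Measurement model: $p(z/X_k=x)$, also written $p(z/x)$, is the single-object observation likelihood of the sensor, and $g(z)$ is the probability (density) that observation $z$ arises from clutter. The multi-object likelihood under $H_{ij}$ is $$p(\{Z_t\}/\{X\},(i,j))=\prod_{k:\,X_{j_k}\in\mathcal{T}}p(z_k/X_{j_k}=x_{j_k})\prod_{k:\,X_{j_k}\in\mathcal{C}}g(z_k).$$ Update: the posterior joint density is defined by Bayes' rule, $$p(\{X\},(i,j)/\mathcal{F}^t)=\frac{p(\{Z_t\}/\{X\},(i,j))\,p^-(\{X\},(i,j)/\mathcal{F}^{t-1})}{\sum_{i',j'}\int p(\{Z_t\}/\{X'\},(i',j'))\,p^-(\{X'\},(i',j')/\mathcal{F}^{t-1})\,d\{X'\}}.$$ The single-object update is $p_{j_k}(x/z_k)=p(z_k/x)p^-_{j_k}(x)\big/\int p(z_k/x')p^-_{j_k}(x')\,dx'$. All normalizing denominators are taken to be positive. *)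

theory Defs
  imports "HOL-Analysis.Analysis"
begin

(* An association maps measurement indices to "Some l" (object l) or "None" (clutter). *)
type_synonym assoc = "nat \<Rightarrow> nat option"

(* prior_pdf i k x      is  p_k(x) under hypothesis i,
   trans_pdf i k x x'   is  p_k(x / x'), with x' the old and x the new state,
   child_prob i j       is  p(j / i),
   obs_lik z x          is  p(z / x). *)
record ('h, 'n::finite, 'z) mot =
  num_obj :: nat
  hyps :: "'h set"
  weight :: "'h \<Rightarrow> real"
  prior_pdf :: "'h \<Rightarrow> nat \<Rightarrow> real ^ 'n \<Rightarrow> real"
  trans_pdf :: "'h \<Rightarrow> nat \<Rightarrow> real ^ 'n \<Rightarrow> real ^ 'n \<Rightarrow> real"
  num_meas :: nat
  meas :: "nat \<Rightarrow> 'z"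
  child_prob :: "'h \<Rightarrow> assoc \<Rightarrow> real"
  obs_lik :: "'z \<Rightarrow> real ^ 'n \<Rightarrow> real"
  clutter_lik :: "'z \<Rightarrow> real"

abbreviation objs :: "('h, 'n::finite, 'z) mot \<Rightarrow> nat set"
  where "objs D \<equiv> {1..num_obj D}"

abbreviation meas_idx :: "('h, 'n::finite, 'z) mot \<Rightarrow> nat set"
  where "meas_idx D \<equiv> {1..num_meas D}"

(* PiE makes associations canonical outside the index set, so that there is exactly one
   child hypothesis (i, j) for each data association j. *)
definition assocs :: "('h, 'n::finite, 'z) mot \<Rightarrow> assoc set"
  where "assocs D = {j \<in> meas_idx D \<rightarrow>\<^sub>E insert None (Some ` objs D).
                       inj_on j {k \<in> meas_idx D. j k \<noteq> None}}"

abbreviation obj_meas :: "('h, 'n::finite, 'z) mot \<Rightarrow> assoc \<Rightarrow> nat set"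
  where "obj_meas D j \<equiv> {k \<in> meas_idx D. j k \<noteq> None}"

abbreviation clutter_meas :: "('h, 'n::finite, 'z) mot \<Rightarrow> assoc \<Rightarrow> nat set"
  where "clutter_meas D j \<equiv> {k \<in> meas_idx D. j k = None}"

definition unassociated :: "('h, 'n::finite, 'z) mot \<Rightarrow> assoc \<Rightarrow> nat set"
  where "unassociated D j = {l \<in> objs D. \<forall>k \<in> meas_idx D. j k \<noteq> Some l}"

definition pdf_on :: "'a measure \<Rightarrow> ('a \<Rightarrow> real) \<Rightarrow> bool"
  where "pdf_on S f \<longleftrightarrow> (\<forall>x \<in> space S. 0 \<le> f x) \<and> has_bochner_integral S f 1"

definition mot_model :: "('h, 'n::finite, 'z) mot \<Rightarrow> bool"
  where "mot_model D \<longleftrightarrow>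
    finite (hyps D) \<and>
    (\<forall>i \<in> hyps D. 0 \<le> weight D i) \<and> (\<Sum>i \<in> hyps D. weight D i) = 1 \<and>
    (\<forall>i \<in> hyps D. (\<forall>j \<in> assocs D. 0 \<le> child_prob D i j) \<and>
                  (\<Sum>j \<in> assocs D. child_prob D i j) = 1) \<and>
    (\<forall>i \<in> hyps D. \<forall>k \<in> objs D. pdf_on lborel (prior_pdf D i k)) \<and>
    (\<forall>i \<in> hyps D. \<forall>k \<in> objs D.
        (\<lambda>(x, x'). trans_pdf D i k x x') \<in> borel_measurable borel \<and>
        (\<forall>x'. pdf_on lborel (\<lambda>x. trans_pdf D i k x x'))) \<and>
    (\<forall>z. obs_lik D z \<in> borel_measurable borel \<and> (\<forall>x. 0 \<le> obs_lik D z x)) \<and>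
    (\<forall>z. 0 \<le> clutter_lik D z)"

(* The multi-object state space: product Lebesgue measure on (real ^ 'n)^M. *)
definition states :: "('h, 'n::finite, 'z) mot \<Rightarrow> (nat \<Rightarrow> real ^ 'n) measure"
  where "states D = Pi\<^sub>M (objs D) (\<lambda>_. lborel)"

(* p({X}, i / F^{t-1}) *)
definition prior_joint :: "('h, 'n::finite, 'z) mot \<Rightarrow> 'h \<Rightarrow> (nat \<Rightarrow> real ^ 'n) \<Rightarrow> real"
  where "prior_joint D i X = weight D i * (\<Prod>k \<in> objs D. prior_pdf D i k (X k))"

(* p({X}, (i,j) / {X'}, i) *)
definition trans_joint ::
    "('h, 'n::finite, 'z) mot \<Rightarrow> 'h \<Rightarrow> assoc \<Rightarrow> (nat \<Rightarrow> real ^ 'n) \<Rightarrow> (nat \<Rightarrow> real ^ 'n) \<Rightarrow> real"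
  where "trans_joint D i j X X' =
    (\<Prod>k \<in> objs D. trans_pdf D i k (X k) (X' k)) * child_prob D i j"

(* p^-({X}, (i,j) / F^{t-1}) *)
definition pred_joint :: "('h, 'n::finite, 'z) mot \<Rightarrow> 'h \<Rightarrow> assoc \<Rightarrow> (nat \<Rightarrow> real ^ 'n) \<Rightarrow> real"
  where "pred_joint D i j X = (\<integral>X'. trans_joint D i j X X' * prior_joint D i X' \<partial>states D)"

(* p_k^-(x) under hypothesis i *)
definition pred_pdf :: "('h, 'n::finite, 'z) mot \<Rightarrow> 'h \<Rightarrow> nat \<Rightarrow> real ^ 'n \<Rightarrow> real"
  where "pred_pdf D i k x = (\<integral>x'. trans_pdf D i k x x' * prior_pdf D i k x' \<partial>lborel)"

(* p({Z_t} / {X}, (i,j)), which does not depend on i *)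
definition multi_lik :: "('h, 'n::finite, 'z) mot \<Rightarrow> assoc \<Rightarrow> (nat \<Rightarrow> real ^ 'n) \<Rightarrow> real"
  where "multi_lik D j X =
    (\<Prod>k \<in> obj_meas D j. obs_lik D (meas D k) (X (the (j k)))) *
    (\<Prod>k \<in> clutter_meas D j. clutter_lik D (meas D k))"

definition evidence :: "('h, 'n::finite, 'z) mot \<Rightarrow> real"
  where "evidence D = (\<Sum>(i, j) \<in> hyps D \<times> assocs D.
                         \<integral>X. multi_lik D j X * pred_joint D i j X \<partial>states D)"

(* p({X}, (i,j) / F^t) *)
definition post_joint :: "('h, 'n::finite, 'z) mot \<Rightarrow> 'h \<Rightarrow> assoc \<Rightarrow> (nat \<Rightarrow> real ^ 'n) \<Rightarrow> real"
  where "post_joint D i j X = multi_lik D j X * pred_joint D i j X / evidence D"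

(* The posterior probability of the child (i,j), and the density p({X} / (i,j), F^t) obtained
   by conditioning the joint posterior on (i,j) *)
definition post_prob :: "('h, 'n::finite, 'z) mot \<Rightarrow> 'h \<Rightarrow> assoc \<Rightarrow> real"
  where "post_prob D i j = (\<integral>X. post_joint D i j X \<partial>states D)"

definition post_cond :: "('h, 'n::finite, 'z) mot \<Rightarrow> 'h \<Rightarrow> assoc \<Rightarrow> (nat \<Rightarrow> real ^ 'n) \<Rightarrow> real"
  where "post_cond D i j X = post_joint D i j X / post_prob D i j"

(* \<integral> p(z / x) p_l^-(x) dx *)
definition obj_meas_lik :: "('h, 'n::finite, 'z) mot \<Rightarrow> 'h \<Rightarrow> nat \<Rightarrow> 'z \<Rightarrow> real"
  where "obj_meas_lik D i l z = (\<integral>x. obs_lik D z x * pred_pdf D i l x \<partial>lborel)"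

(* p_l(x / z) *)
definition obj_update :: "('h, 'n::finite, 'z) mot \<Rightarrow> 'h \<Rightarrow> nat \<Rightarrow> 'z \<Rightarrow> real ^ 'n \<Rightarrow> real"
  where "obj_update D i l z x = obs_lik D z x * pred_pdf D i l x / obj_meas_lik D i l z"

(* p(z_k / X_{j_k}) *)
definition meas_lik :: "('h, 'n::finite, 'z) mot \<Rightarrow> 'h \<Rightarrow> assoc \<Rightarrow> nat \<Rightarrow> real"
  where "meas_lik D i j k = (case j k of Some l \<Rightarrow> obj_meas_lik D i l (meas D k)
                                       | None \<Rightarrow> clutter_lik D (meas D k))"

(* w_ij and l_ij *)
definition child_weight :: "('h, 'n::finite, 'z) mot \<Rightarrow> 'h \<Rightarrow> assoc \<Rightarrow> real"
  where "child_weight D i j = child_prob D i j * weight D i"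

definition child_lik :: "('h, 'n::finite, 'z) mot \<Rightarrow> 'h \<Rightarrow> assoc \<Rightarrow> real"
  where "child_lik D i j = (\<Prod>k \<in> meas_idx D. meas_lik D i j k)"

definition updated_pdf :: "('h, 'n::finite, 'z) mot \<Rightarrow> 'h \<Rightarrow> assoc \<Rightarrow> (nat \<Rightarrow> real ^ 'n) \<Rightarrow> real"
  where "updated_pdf D i j X =
    (\<Prod>k \<in> obj_meas D j. obj_update D i (the (j k)) (meas D k) (X (the (j k)))) *
    (\<Prod>l \<in> unassociated D j. pred_pdf D i l (X l))"

end

theory Submission
  imports Defs
begin

text \<open>
  Up to the constants \<open>child_weight D i j\<close> and the clutter likelihoods, the numerator of Bayes' rule
  is a product over the objects of functions of the single-object states: \<open>p(z\<^sub>k/x) p\<^sup>-(x)\<close> for the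
  object observed by \<open>z\<^sub>k\<close>, and \<open>p\<^sup>-(x)\<close> for an unassociated object. By Tonelli its integral
  factors, unassociated objects contributing 1, so it equals \<open>w\<^sub>i\<^sub>j l\<^sub>i\<^sub>j\<close>; dividing each factor by
  its integral gives the updated density. All integrands are nonnegative, and for those the integral
  of a product of functions of separate variables is the product of the integrals even when some
  factor is not integrable (both sides are then 0).
\<close>

section \<open>Integrals of products of nonnegative functions\<close>

lemma enn2real_prod: "enn2real (\<Prod>i\<in>I. f i) = (\<Prod>i\<in>I. enn2real (f i))"
  by (induction I rule: infinite_finite_induct) (simp_all add: enn2real_mult)

text \<open>Tonelli in \<open>ennreal\<close>, transferred back by \<open>enn2real\<close>: this map
  is multiplicative and sends \<infinity> to 0, which is also the default value of a Bochner
  integral that does not exist.\<close>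

lemma (in product_sigma_finite) product_integral_prod_nonneg:
  fixes f :: "'i \<Rightarrow> 'a \<Rightarrow> real"
  assumes "finite I"
    and [measurable]: "\<And>i. i \<in> I \<Longrightarrow> f i \<in> borel_measurable (M i)"
    and nn: "\<And>i x. i \<in> I \<Longrightarrow> x \<in> space (M i) \<Longrightarrow> 0 \<le> f i x"
  shows "(\<integral>x. (\<Prod>i\<in>I. f i (x i)) \<partial>Pi\<^sub>M I M) = (\<Prod>i\<in>I. \<integral>x. f i x \<partial>M i)"
proof -
  have sp: "x i \<in> space (M i)" if "x \<in> space (Pi\<^sub>M I M)" "i \<in> I" for x i
    using that by (auto simp: space_PiM)
  have "(\<integral>x. (\<Prod>i\<in>I. f i (x i)) \<partial>Pi\<^sub>M I M)
      = enn2real (\<integral>\<^sup>+x. ennreal (\<Prod>i\<in>I. f i (x i)) \<partial>Pi\<^sub>M I M)"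
    by (intro integral_eq_nn_integral AE_I2 prod_nonneg ballI nn sp) measurable
  also have "(\<integral>\<^sup>+x. ennreal (\<Prod>i\<in>I. f i (x i)) \<partial>Pi\<^sub>M I M)
      = (\<integral>\<^sup>+x. (\<Prod>i\<in>I. ennreal (f i (x i))) \<partial>Pi\<^sub>M I M)"
    by (intro nn_integral_cong prod_ennreal[symmetric] nn sp)
  also have "\<dots> = (\<Prod>i\<in>I. \<integral>\<^sup>+x. ennreal (f i x) \<partial>M i)"
    using \<open>finite I\<close> by (intro product_nn_integral_prod) simp_all
  also have "enn2real \<dots> = (\<Prod>i\<in>I. \<integral>x. f i x \<partial>M i)"
    unfolding enn2real_prod
    by (intro prod.cong refl integral_eq_nn_integral[symmetric] AE_I2 nn) simp_all
  finally show ?thesis .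
qed

text \<open>A non-integrable function has integral 0 by convention, so the value 1 already forces
  integrability.\<close>

lemma pdf_on_iff: "pdf_on S f \<longleftrightarrow> (\<forall>x\<in>space S. 0 \<le> f x) \<and> (\<integral>x. f x \<partial>S) = 1"
  unfolding pdf_on_def has_bochner_integral_iff
  using not_integrable_integral_eq[of S f] by fastforce

lemma integral_states_prod:
  fixes D :: "('h, 'n::finite, 'z) mot" and f :: "nat \<Rightarrow> real ^ 'n \<Rightarrow> real"
  assumes "\<And>l. l \<in> objs D \<Longrightarrow> f l \<in> borel_measurable borel"
    and "\<And>l x. l \<in> objs D \<Longrightarrow> 0 \<le> f l x"
  shows "(\<integral>X. (\<Prod>l\<in>objs D. f l (X l)) \<partial>states D) = (\<Prod>l\<in>objs D. \<integral>x. f l x \<partial>lborel)"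
proof -
  interpret product_sigma_finite "\<lambda>_. lborel :: (real ^ 'n) measure" ..
  show ?thesis
    unfolding states_def using assms by (intro product_integral_prod_nonneg) simp_all
qed

section \<open>Data associations and products over the objects\<close>

lemma assoc_mem_objs:
  assumes "j \<in> assocs D" "k \<in> obj_meas D j"
  shows "the (j k) \<in> objs D"
proof -
  have "j k \<in> insert None (Some ` objs D)"
    using assms by (auto simp: assocs_def simp del: insert_iff)
  with assms show ?thesis by auto
qed

lemma assoc_inj: "j \<in> assocs D \<Longrightarrow> inj_on (\<lambda>k. the (j k)) (obj_meas D j)"
  by (auto simp: assocs_def inj_on_def)

text \<open>Reindexing by the inverse of \<open>k \<mapsto> j\<^sub>k\<close>, which is injective on the object measurements.\<close>

lemma prod_assoc:
  fixes D :: "('h, 'n::finite, 'z) mot" and F :: "nat \<Rightarrow> nat \<Rightarrow> 'a::comm_monoid_mult"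
  assumes j: "j \<in> assocs D"
  shows "(\<Prod>k\<in>obj_meas D j. F k (the (j k))) * (\<Prod>l\<in>unassociated D j. G l)
    = (\<Prod>l\<in>objs D. if l \<in> unassociated D j then G l
         else F (the_inv_into (obj_meas D j) (\<lambda>k. the (j k)) l) l)"
    (is "_ = (\<Prod>l\<in>_. ?H l)")
proof -
  let ?t = "\<lambda>k. the (j k)" and ?K = "obj_meas D j" and ?U = "unassociated D j"
  note inj = assoc_inj[OF j]
  \<comment> \<open>Every object is either hit by exactly one measurement or unassociated; these are
    the two branches of \<open>?H\<close>.\<close>
  have objs: "objs D = ?t ` ?K \<union> ?U"
  proof
    show "objs D \<subseteq> ?t ` ?K \<union> ?U"
      by (force simp: unassociated_def)
    show "?t ` ?K \<union> ?U \<subseteq> objs D"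
      using assoc_mem_objs[OF j] by (fastforce simp: unassociated_def)
  qed
  have disj: "?t ` ?K \<inter> ?U = {}"
    by (auto simp: unassociated_def)
  have "finite ?U"
    by (simp add: unassociated_def)
  then have "(\<Prod>l\<in>objs D. ?H l) = (\<Prod>l\<in>?t ` ?K. ?H l) * (\<Prod>l\<in>?U. ?H l)"
    unfolding objs using disj by (intro prod.union_disjoint) simp_all
  also have "(\<Prod>l\<in>?t ` ?K. ?H l) = (\<Prod>k\<in>?K. ?H (?t k))"
    using inj by (simp add: prod.reindex)
  also have "\<dots> = (\<Prod>k\<in>?K. F k (?t k))"
  proof (rule prod.cong[OF refl])
    fix k assume k: "k \<in> ?K"
    then have "?t k \<notin> ?U"
      using disj by blast
    then show "?H (?t k) = F k (?t k)"
      by (simp only: if_False the_inv_into_f_f[OF inj k])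
  qed
  also have "(\<Prod>l\<in>?U. ?H l) = (\<Prod>l\<in>?U. G l)"
    by simp
  finally show ?thesis by simp
qed

text \<open>\<open>prod_assoc\<close> merges both products into one with a single factor
  \<open>h l\<close> per object, so the integral factors over the objects; \<open>prod_assoc\<close>
  read backwards then sorts the integrals by measurement again.\<close>

lemma integral_prod_assoc:
  fixes D :: "('h, 'n::finite, 'z) mot"
    and f :: "nat \<Rightarrow> nat \<Rightarrow> real ^ 'n \<Rightarrow> real" and g :: "nat \<Rightarrow> real ^ 'n \<Rightarrow> real"
  assumes j: "j \<in> assocs D"
    and f: "\<And>k l. k \<in> obj_meas D j \<Longrightarrow> l \<in> objs D \<Longrightarrow> f k l \<in> borel_measurable borel"
      "\<And>k l x. k \<in> obj_meas D j \<Longrightarrow> l = the (j k) \<Longrightarrow> 0 \<le> f k l x"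
    and g: "\<And>l. l \<in> objs D \<Longrightarrow> g l \<in> borel_measurable borel"
      "\<And>l x. l \<in> objs D \<Longrightarrow> 0 \<le> g l x"
  shows "(\<integral>X. (\<Prod>k\<in>obj_meas D j. f k (the (j k)) (X (the (j k)))) *
              (\<Prod>l\<in>unassociated D j. g l (X l)) \<partial>states D)
    = (\<Prod>k\<in>obj_meas D j. \<integral>x. f k (the (j k)) x \<partial>lborel) *
      (\<Prod>l\<in>unassociated D j. \<integral>x. g l x \<partial>lborel)"
proof -
  let ?t = "\<lambda>k. the (j k)" and ?K = "obj_meas D j" and ?U = "unassociated D j"
  define \<kappa> where "\<kappa> = the_inv_into ?K ?t"
  define h where "h l = (if l \<in> ?U then g l else f (\<kappa> l) l)" for l
  \<comment> \<open>\<open>\<kappa> l\<close> is the measurement assigned to \<open>l\<close>. The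
    second fact is what makes \<open>f (\<kappa> l) l\<close> nonnegative, since the sign of
    \<open>f k l\<close> is known only for matching pairs.\<close>
  have \<kappa>: "\<kappa> l \<in> ?K" "the (j (\<kappa> l)) = l" if "l \<in> objs D" "l \<notin> ?U" for l
  proof -
    note inj = assoc_inj[OF j]
    have "l \<in> ?t ` ?K"
      using that by (force simp: unassociated_def)
    then show "\<kappa> l \<in> ?K" "the (j (\<kappa> l)) = l"
      unfolding \<kappa>_def by (rule the_inv_into_into[OF inj _ order_refl], rule f_the_inv_into_f[OF inj])
  qed
  have "(\<integral>X. (\<Prod>k\<in>?K. f k (?t k) (X (?t k))) * (\<Prod>l\<in>?U. g l (X l)) \<partial>states D)
      = (\<integral>X. (\<Prod>l\<in>objs D. h l (X l)) \<partial>states D)"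
    unfolding prod_assoc[OF j, of "\<lambda>k l. f k l (X l)" "\<lambda>l. g l (X l)" for X]
    by (intro Bochner_Integration.integral_cong refl prod.cong) (simp add: h_def \<kappa>_def)
  also have "\<dots> = (\<Prod>l\<in>objs D. \<integral>x. h l x \<partial>lborel)"
  proof (rule integral_states_prod)
    fix l assume l: "l \<in> objs D"
    show "h l \<in> borel_measurable borel"
      using f(1)[OF \<kappa>(1)[OF l] l] g(1)[OF l] by (cases "l \<in> ?U") (simp_all add: h_def[abs_def])
    show "0 \<le> h l x" for x
      using f(2)[OF \<kappa>(1)[OF l] \<kappa>(2)[OF l, symmetric]] g(2)[OF l]
      by (cases "l \<in> ?U") (simp_all add: h_def)
  qed
  also have "\<dots> = (\<Prod>k\<in>?K. \<integral>x. f k (?t k) x \<partial>lborel) * (\<Prod>l\<in>?U. \<integral>x. g l x \<partial>lborel)"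
    unfolding prod_assoc[OF j, of "\<lambda>k l. \<integral>x. f k l x \<partial>lborel" "\<lambda>l. \<integral>x. g l x \<partial>lborel"]
    by (intro prod.cong refl) (simp add: h_def \<kappa>_def)
  finally show ?thesis .
qed

section \<open>Factorization of the likelihoods\<close>

lemma multi_lik_split:
  fixes D :: "('h, 'n::finite, 'z) mot"
  assumes j: "j \<in> assocs D"
  shows "multi_lik D j X * (\<Prod>l\<in>objs D. q l (X l))
    = ((\<Prod>k\<in>obj_meas D j. obs_lik D (meas D k) (X (the (j k))) * q (the (j k)) (X (the (j k)))) *
       (\<Prod>l\<in>unassociated D j. q l (X l))) * (\<Prod>k\<in>clutter_meas D j. clutter_lik D (meas D k))"
proof -
  \<comment> \<open>With \<open>F\<close> constant in the measurement, \<open>prod_assoc\<close>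
    splits this product along \<open>j\<close>; each \<open>q\<close> can then join the observation
    likelihood of the same object.\<close>
  have "(\<Prod>l\<in>objs D. q l (X l))
      = (\<Prod>k\<in>obj_meas D j. q (the (j k)) (X (the (j k)))) * (\<Prod>l\<in>unassociated D j. q l (X l))"
    using prod_assoc[OF j, of "\<lambda>k l. q l (X l)" "\<lambda>l. q l (X l)"] by simp
  then show ?thesis
    by (simp add: multi_lik_def prod.distrib ac_simps)
qed

lemma child_lik_split:
  "child_lik D i j = (\<Prod>k\<in>obj_meas D j. obj_meas_lik D i (the (j k)) (meas D k)) *
     (\<Prod>k\<in>clutter_meas D j. clutter_lik D (meas D k))"
proof -
  have "child_lik D i j = (\<Prod>k\<in>obj_meas D j \<union> clutter_meas D j. meas_lik D i j k)"
    unfolding child_lik_def by (rule prod.cong) auto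
  also have "\<dots> = (\<Prod>k\<in>obj_meas D j. meas_lik D i j k) * (\<Prod>k\<in>clutter_meas D j. meas_lik D i j k)"
    by (rule prod.union_disjoint) auto
  finally show ?thesis
    by (auto simp: meas_lik_def intro!: arg_cong2[where f = "(*)"] prod.cong)
qed

section \<open>Single-object densities and the predicted prior\<close>

context
  fixes D :: "('h, 'n::finite, 'z) mot"
  assumes model: "mot_model D"
begin

lemma obs_lik_measurable [measurable]: "obs_lik D z \<in> borel_measurable borel"
  and obs_lik_nonneg: "0 \<le> obs_lik D z x"
  using model by (auto simp: mot_model_def)

context
  fixes i assumes i: "i \<in> hyps D"
begin

context
  fixes k assumes k: "k \<in> objs D"
begin

lemma prior_pdf_measurable [measurable]: "prior_pdf D i k \<in> borel_measurable borel"
  and prior_pdf_nonneg: "0 \<le> prior_pdf D i k x"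
  and prior_pdf_integrable: "integrable lborel (prior_pdf D i k)"
  and integral_prior_pdf: "(\<integral>x. prior_pdf D i k x \<partial>lborel) = 1"
proof -
  have "pdf_on lborel (prior_pdf D i k)"
    using model i k by (auto simp: mot_model_def)
  then show "0 \<le> prior_pdf D i k x" "integrable lborel (prior_pdf D i k)"
    "(\<integral>x. prior_pdf D i k x \<partial>lborel) = 1"
    by (auto simp: pdf_on_def has_bochner_integral_iff)
  then show "prior_pdf D i k \<in> borel_measurable borel"
    by (auto dest: borel_measurable_integrable)
qed

lemma trans_pdf_measurable [measurable]:
    "(\<lambda>(x, x'). trans_pdf D i k x x') \<in> borel_measurable (borel \<Otimes>\<^sub>M borel)"
  and trans_pdf_nonneg: "0 \<le> trans_pdf D i k x x'"
  and trans_pdf_integrable: "integrable lborel (\<lambda>x. trans_pdf D i k x x')"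
  and integral_trans_pdf: "(\<integral>x. trans_pdf D i k x x' \<partial>lborel) = 1"
proof -
  have *: "(\<lambda>(x, x'). trans_pdf D i k x x') \<in> borel_measurable borel"
    "pdf_on lborel (\<lambda>x. trans_pdf D i k x x')"
    using model i k by (auto simp: mot_model_def)
  \<comment> \<open>The Borel algebra of the product space is the product of the Borel
    algebras.\<close>
  show "(\<lambda>(x, x'). trans_pdf D i k x x') \<in> borel_measurable (borel \<Otimes>\<^sub>M borel)"
    using *(1) by (simp add: borel_prod)
  show "0 \<le> trans_pdf D i k x x'" "integrable lborel (\<lambda>x. trans_pdf D i k x x')"
    "(\<integral>x. trans_pdf D i k x x' \<partial>lborel) = 1"
    using *(2) by (auto simp: pdf_on_def has_bochner_integral_iff)
qed

lemma trans_prior_measurable: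
  "(\<lambda>(x, x'). trans_pdf D i k x x' * prior_pdf D i k x') \<in> borel_measurable (borel \<Otimes>\<^sub>M borel)"
  by measurable

lemma pred_pdf_measurable [measurable]: "pred_pdf D i k \<in> borel_measurable borel"
proof -
  have "(\<lambda>(x, x'). trans_pdf D i k x x' * prior_pdf D i k x') \<in> borel_measurable (borel \<Otimes>\<^sub>M lborel)"
    using trans_prior_measurable by (simp cong: measurable_cong_sets sets_pair_measure_cong)
  then show ?thesis
    unfolding pred_pdf_def[abs_def] by (rule lborel.borel_measurable_lebesgue_integral)
qed

lemma pred_pdf_nonneg: "0 \<le> pred_pdf D i k x"
  by (simp add: pred_pdf_def trans_pdf_nonneg prior_pdf_nonneg)

text \<open>Fubini: integrating over the new state first gives 1 for every old state, and the prior
  then has mass 1.\<close>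

lemma integral_pred_pdf: "(\<integral>x. pred_pdf D i k x \<partial>lborel) = 1"
proof -
  let ?f = "\<lambda>x x'. trans_pdf D i k x x' * prior_pdf D i k x'"
  have "integrable (lborel \<Otimes>\<^sub>M lborel) (\<lambda>(x', x). ?f x x')"
  proof (rule lborel_pair.Fubini_integrable)
    have "(\<lambda>(x', x). ?f x x') \<in> borel_measurable (borel \<Otimes>\<^sub>M borel)"
      by measurable
    then show "(\<lambda>(x', x). ?f x x') \<in> borel_measurable (lborel \<Otimes>\<^sub>M lborel)"
      by (simp cong: measurable_cong_sets sets_pair_measure_cong)
    \<comment> \<open>With the old state outermost, the inner integral of the norm is just
      \<open>prior_pdf D i k x'\<close>.\<close>
    show "integrable lborel (\<lambda>x'. \<integral>x. norm (case (x', x) of (x', x) \<Rightarrow> ?f x x') \<partial>lborel)"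
      by (simp add: abs_mult trans_pdf_nonneg prior_pdf_nonneg integral_trans_pdf
          prior_pdf_integrable)
    show "AE x' in lborel. integrable lborel (\<lambda>x. case (x', x) of (x', x) \<Rightarrow> ?f x x')"
      by (simp add: trans_pdf_integrable)
  qed
  then have "(\<integral>x. (\<integral>x'. ?f x x' \<partial>lborel) \<partial>lborel) = (\<integral>x'. (\<integral>x. ?f x x' \<partial>lborel) \<partial>lborel)"
    by (rule lborel_pair.Fubini_integral)
  then show ?thesis
    by (simp add: pred_pdf_def integral_trans_pdf integral_prior_pdf)
qed

end

section \<open>Prediction and update of the joint density\<close>

lemma pred_joint_eq:
  "pred_joint D i j X = child_weight D i j * (\<Prod>l\<in>objs D. pred_pdf D i l (X l))"
proof -
  \<comment> \<open>Neither \<open>child_prob\<close> nor \<open>weight\<close> depends on the old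
    state, so both leave the integral; what remains has one factor per object.\<close>
  have "pred_joint D i j X = child_weight D i j *
      (\<integral>X'. (\<Prod>k\<in>objs D. trans_pdf D i k (X k) (X' k) * prior_pdf D i k (X' k)) \<partial>states D)"
    unfolding pred_joint_def trans_joint_def prior_joint_def child_weight_def
    by (subst integral_mult_right_zero[symmetric]) (simp add: prod.distrib ac_simps)
  also have "(\<integral>X'. (\<Prod>k\<in>objs D. trans_pdf D i k (X k) (X' k) * prior_pdf D i k (X' k)) \<partial>states D)
      = (\<Prod>k\<in>objs D. pred_pdf D i k (X k))"
    unfolding pred_pdf_def
  proof (rule integral_states_prod)
    fix l assume l: "l \<in> objs D"
    show "(\<lambda>x'. trans_pdf D i l (X l) x' * prior_pdf D i l x') \<in> borel_measurable borel"
      using measurable_Pair2[OF trans_prior_measurable[OF l], of "X l"] by simp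
  qed (simp add: trans_pdf_nonneg prior_pdf_nonneg)
  finally show ?thesis .
qed

context
  fixes j assumes j: "j \<in> assocs D"
begin

text \<open>Associated objects contribute \<open>obj_meas_lik\<close>, unassociated ones mass 1, and
  clutter a constant. The identity covers children of zero likelihood too, since
  \<open>evidence\<close> sums over all children.\<close>

lemma integral_joint:
  "(\<integral>X. multi_lik D j X * pred_joint D i j X \<partial>states D) = child_weight D i j * child_lik D i j"
proof -
  let ?P = "\<lambda>X. (\<Prod>k\<in>obj_meas D j. obs_lik D (meas D k) (X (the (j k))) *
        pred_pdf D i (the (j k)) (X (the (j k)))) * (\<Prod>l\<in>unassociated D j. pred_pdf D i l (X l))"
  let ?c = "\<Prod>k\<in>clutter_meas D j. clutter_lik D (meas D k)"
  have "(\<integral>X. ?P X \<partial>states D)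
      = (\<Prod>k\<in>obj_meas D j. \<integral>x. obs_lik D (meas D k) x * pred_pdf D i (the (j k)) x \<partial>lborel) *
        (\<Prod>l\<in>unassociated D j. \<integral>x. pred_pdf D i l x \<partial>lborel)"
  proof (rule integral_prod_assoc[OF j, where
        f = "\<lambda>k l x. obs_lik D (meas D k) x * pred_pdf D i l x" and g = "pred_pdf D i"])
    fix k l x assume "k \<in> obj_meas D j" "l = the (j k)"
    then have "l \<in> objs D"
      using assoc_mem_objs[OF j] by blast
    then show "0 \<le> obs_lik D (meas D k) x * pred_pdf D i l x"
      by (intro mult_nonneg_nonneg obs_lik_nonneg pred_pdf_nonneg)
  qed (simp_all add: borel_measurable_times obs_lik_measurable pred_pdf_measurable pred_pdf_nonneg)
  also have "(\<Prod>l\<in>unassociated D j. \<integral>x. pred_pdf D i l x \<partial>lborel) = 1"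
    by (intro prod.neutral ballI integral_pred_pdf) (simp add: unassociated_def)
  finally have P: "(\<integral>X. ?P X \<partial>states D)
      = (\<Prod>k\<in>obj_meas D j. obj_meas_lik D i (the (j k)) (meas D k))"
    by (simp add: obj_meas_lik_def)
  have "multi_lik D j X * pred_joint D i j X = child_weight D i j * ?c * ?P X" for X
    using multi_lik_split[OF j, of X "pred_pdf D i"] by (simp add: pred_joint_eq ac_simps)
  then have "(\<integral>X. multi_lik D j X * pred_joint D i j X \<partial>states D)
      = child_weight D i j * ?c * (\<integral>X. ?P X \<partial>states D)"
    by simp
  then show ?thesis
    unfolding P child_lik_split by (simp only: ac_simps)
qed

context
  assumes pos: "\<forall>k\<in>meas_idx D. \<forall>l. j k = Some l \<longrightarrow> 0 < obj_meas_lik D i l (meas D k)"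
begin

lemma obj_meas_lik_pos: "k \<in> obj_meas D j \<Longrightarrow> 0 < obj_meas_lik D i (the (j k)) (meas D k)"
  using pos by auto

text \<open>Dividing each observed factor by its normalizer turns it into \<open>obj_update\<close>;
  the normalizers collected this way are the object part of \<open>child_lik\<close>.\<close>

lemma joint_eq_updated_pdf:
  "multi_lik D j X * pred_joint D i j X
    = updated_pdf D i j X * (child_weight D i j * child_lik D i j)"
proof -
  let ?m = "\<lambda>k. obj_meas_lik D i (the (j k)) (meas D k)"
  \<comment> \<open>Stated for the whole product because \<open>prod_dividef\<close> gathers the
    normalizers into this one denominator, which then cancels.\<close>
  have "(\<Prod>k\<in>obj_meas D j. ?m k) \<noteq> 0"
    using prod_pos[OF obj_meas_lik_pos] by (rule less_imp_neq[symmetric])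
  moreover have "multi_lik D j X * pred_joint D i j X
      = child_weight D i j * (multi_lik D j X * (\<Prod>l\<in>objs D. pred_pdf D i l (X l)))"
    by (simp add: pred_joint_eq)
  ultimately show ?thesis
    unfolding multi_lik_split[OF j] updated_pdf_def obj_update_def prod_dividef child_lik_split
    by (simp del: prod_zero_iff)
qed

text \<open>The integral factors over the objects, and every factor is a normalized density;
  integrability follows through \<open>pdf_on_iff\<close>.\<close>

lemma pdf_on_updated_pdf: "pdf_on (states D) (updated_pdf D i j)"
  unfolding pdf_on_iff
proof
  have upd: "0 \<le> obj_update D i (the (j k)) (meas D k) x" if "k \<in> obj_meas D j" for k x
    using obj_meas_lik_pos[OF that] assoc_mem_objs[OF j that]
    by (auto simp: obj_update_def obs_lik_nonneg pred_pdf_nonneg)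
  have un: "l \<in> objs D" if "l \<in> unassociated D j" for l
    using that by (simp add: unassociated_def)
  show "\<forall>X\<in>space (states D). 0 \<le> updated_pdf D i j X"
    unfolding updated_pdf_def
    by (intro ballI mult_nonneg_nonneg prod_nonneg upd pred_pdf_nonneg un)
  have "(\<integral>X. updated_pdf D i j X \<partial>states D)
      = (\<Prod>k\<in>obj_meas D j. \<integral>x. obj_update D i (the (j k)) (meas D k) x \<partial>lborel) *
        (\<Prod>l\<in>unassociated D j. \<integral>x. pred_pdf D i l x \<partial>lborel)"
    unfolding updated_pdf_def
  proof (rule integral_prod_assoc[OF j, where
        f = "\<lambda>k l x. obj_update D i l (meas D k) x" and g = "pred_pdf D i"])
    fix k l assume l: "l \<in> objs D"
    note [measurable] = pred_pdf_measurable[OF l]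
    show "(\<lambda>x. obj_update D i l (meas D k) x) \<in> borel_measurable borel"
      unfolding obj_update_def by measurable
  qed (simp_all add: upd pred_pdf_measurable pred_pdf_nonneg)
  also have "(\<Prod>l\<in>unassociated D j. \<integral>x. pred_pdf D i l x \<partial>lborel) = 1"
    by (intro prod.neutral ballI integral_pred_pdf un)
  also have "(\<Prod>k\<in>obj_meas D j. \<integral>x. obj_update D i (the (j k)) (meas D k) x \<partial>lborel) = 1"
  proof (intro prod.neutral ballI)
    fix k assume "k \<in> obj_meas D j"
    from obj_meas_lik_pos[OF this]
    \<comment> \<open>The constant denominator equals the integral of the numerator; positivity
      excludes 0/0, which would be 0.\<close>
    show "(\<integral>x. obj_update D i (the (j k)) (meas D k) x \<partial>lborel) = 1"
      by (simp add: obj_update_def obj_meas_lik_def)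
  qed
  finally show "(\<integral>X. updated_pdf D i j X \<partial>states D) = 1"
    by simp
qed

end

end

end

section \<open>Normalization and the posterior\<close>

lemma evidence_eq:
  "evidence D = (\<Sum>(i, j)\<in>hyps D \<times> assocs D. child_weight D i j * child_lik D i j)"
  unfolding evidence_def by (intro sum.cong refl) (auto simp: integral_joint)

end

theorem proposition1:
  fixes D :: "('h, 'n::finite, 'z) mot" and i :: 'h and j :: assoc
  assumes "mot_model D"
    and "i \<in> hyps D" and "j \<in> assocs D"
    and "0 < evidence D"
    and "\<forall>k \<in> meas_idx D. \<forall>l. j k = Some l \<longrightarrow> 0 < obj_meas_lik D i l (meas D k)"
  shows "(\<forall>X \<in> space (states D).
            post_joint D i j X =
              updated_pdf D i j X *
              (child_weight D i j * child_lik D i j /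
                (\<Sum>(i', j') \<in> hyps D \<times> assocs D. child_weight D i' j' * child_lik D i' j'))) \<and>
         pdf_on (states D) (updated_pdf D i j) \<and>
         (0 < post_prob D i j \<longrightarrow>
            (\<forall>X \<in> space (states D). post_cond D i j X = updated_pdf D i j X))"
proof -
  define c where "c = child_weight D i j * child_lik D i j / evidence D"
  have post: "post_joint D i j X = updated_pdf D i j X * c" for X
    using joint_eq_updated_pdf[OF assms(1-3,5), of X] by (simp add: post_joint_def c_def)
  have pdf: "pdf_on (states D) (updated_pdf D i j)"
    using assms by (intro pdf_on_updated_pdf)
  \<comment> \<open>Integrating \<open>post\<close> with the unit mass from \<open>pdf\<close>
    identifies \<open>c\<close> as the posterior probability of the child; conditioning divides by
    it, leaving \<open>updated_pdf\<close>.\<close>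
  then have "post_prob D i j = c"
    by (simp add: post_prob_def post pdf_on_iff)
  then have "0 < post_prob D i j \<longrightarrow> (\<forall>X\<in>space (states D). post_cond D i j X = updated_pdf D i j X)"
    by (simp add: post_cond_def post)
  with post pdf show ?thesis
    unfolding c_def evidence_eq[OF assms(1)] by blast
qed

end
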